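(* Let $G=(V,E)$ be an $n$-vertex simple graph with $\lambda(G)<\delta(G)$. Perform uniform star contraction with $p=\frac{1200\ln n}{\delta(G)}$, producing the multigraph $G'$. Then (1) $G'$ has at most $2400\, n\ln(n)/\delta(G)$ vertices with probability at least $1-1/n^4$, and (2) $\lambda(G')=\lambda(G)$ with probability at least $2\cdot 3^{-13}$.
   Context: A simple graph is undirected, unweighted, loopless, with at most one edge between any pair of vertices. $\mathrm{cut}_G(S)$ is the set of edges with exactly one endpoint in $S$; $\lambda(G)=\min_{\emptyset\neq S\subsetneq V}|\mathrm{cut}_G(S)|$ is the edge connectivity; $\delta(G)$ is the minimum degree. Contraction: for $F\subseteq E$, the graph obtained by contracting $F$ is the multigraph $G'$ whose vertices (supervertices) are the vertex sets of the connected components of $(V,F)$, and with $|E_G(S,T)|$ parallel edges between distinct supervertices $S,T$, where $E_G(S,T)$ is the set of edges of $G$ with one endpoint in $S$ and the other in $T$; $\lambda(G')$ is the minimum number of edges of $G'$ crossing a partition of its supervertices into two nonempty parts. Uniform star contraction with parameter $p$: put each vertex of $V$ into a set $R$ independently with probability $p$; then independently for each $v\in V\setminus R$ that has at least one neighbor in $R$, choose a neighbor $c\in R$ of $v$ uniformly at random and put $\{v,c\}$ into a set $X$; output the graph obtained from $G$ by contracting $X$. *)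

theory Defs
  imports "HOL-Probability.Probability"
begin

text \<open>An undirected edge is the set of its two endpoints.\<close>

definition simple_graph :: "'a set \<Rightarrow> 'a set set \<Rightarrow> bool" where
  "simple_graph V E \<longleftrightarrow> finite V \<and> (\<forall>e\<in>E. e \<subseteq> V \<and> card e = 2)"

definition neighbors :: "'a set set \<Rightarrow> 'a \<Rightarrow> 'a set" where
  "neighbors E v = {u. {v, u} \<in> E}"

definition vertex_degree :: "'a set set \<Rightarrow> 'a \<Rightarrow> nat" where
  "vertex_degree E v = card {e \<in> E. v \<in> e}"

definition min_degree :: "'a set \<Rightarrow> 'a set set \<Rightarrow> nat" where
  "min_degree V E = (INF v\<in>V. vertex_degree E v)"

definition edge_cut :: "'a set set \<Rightarrow> 'a set \<Rightarrow> 'a set set" where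
  "edge_cut E S = {e \<in> E. card (e \<inter> S) = 1}"

text \<open>The infimum of an empty set of naturals is 0. So a graph with fewer than two vertices has
  edge connectivity 0 (and does not satisfy \<open>edge_connectivity V E < min_degree V E\<close>).\<close>

definition edge_connectivity :: "'a set \<Rightarrow> 'a set set \<Rightarrow> nat" where
  "edge_connectivity V E = (INF S\<in>{S. S \<noteq> {} \<and> S \<subset> V}. card (edge_cut E S))"

definition edges_between :: "'a set set \<Rightarrow> 'a set \<Rightarrow> 'a set \<Rightarrow> 'a set set" where
  "edges_between E S T = {e \<in> E. \<exists>u\<in>S. \<exists>v\<in>T. e = {u, v}}"

text \<open>A loopless multigraph: its vertex set, and the number of parallel edges between two
  vertices.\<close>

record 'v multigraph =
  mverts :: "'v set"
  mult :: "'v \<Rightarrow> 'v \<Rightarrow> nat"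

text \<open>As above, the value is 0 if there are fewer than two vertices. If all of a graph is contracted
  to one supervertex, that graph is connected; so with at least two vertices it has positive edge
  connectivity, and the convention does not make the two edge connectivities agree.\<close>

definition medge_connectivity :: "'v multigraph \<Rightarrow> nat" where
  "medge_connectivity H =
     (INF A\<in>{A. A \<noteq> {} \<and> A \<subset> mverts H}. \<Sum>S\<in>A. \<Sum>T\<in>mverts H - A. mult H S T)"

definition connected_comps :: "'a set \<Rightarrow> 'a set set \<Rightarrow> 'a set set" where
  "connected_comps V F = (\<lambda>v. {u \<in> V. (v, u) \<in> {(x, y). {x, y} \<in> F}\<^sup>*}) ` V"

definition contract :: "'a set \<Rightarrow> 'a set set \<Rightarrow> 'a set set \<Rightarrow> 'a set multigraph" where
  "contract V E F =
     \<lparr>mverts = connected_comps V F,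
      mult = (\<lambda>S T. if S \<in> connected_comps V F \<and> T \<in> connected_comps V F \<and> S \<noteq> T
                     then card (edges_between E S T) else 0)\<rparr>"

text \<open>\<^const>\<open>bernoulli_pmf\<close> truncates its parameter to the unit interval; so for \<open>p \<ge> 1\<close> this is
  all of \<open>V\<close>.\<close>

definition random_subset :: "'a set \<Rightarrow> real \<Rightarrow> 'a set pmf" where
  "random_subset V p =
     map_pmf (\<lambda>f. {v \<in> V. f v}) (Pi_pmf V False (\<lambda>_. bernoulli_pmf p))"

definition attached :: "'a set \<Rightarrow> 'a set set \<Rightarrow> 'a set \<Rightarrow> 'a set" where
  "attached V E R = {v \<in> V - R. neighbors E v \<inter> R \<noteq> {}}"

definition uniform_star_contraction ::
  "'a set \<Rightarrow> 'a set set \<Rightarrow> real \<Rightarrow> 'a set multigraph pmf" where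
  "uniform_star_contraction V E p =
     do {
       R \<leftarrow> random_subset V p;
       c \<leftarrow> Pi_pmf (attached V E R) undefined (\<lambda>v. pmf_of_set (neighbors E v \<inter> R));
       return_pmf (contract V E ((\<lambda>v. {v, c v}) ` attached V E R))
     }"

end

theory Submission
  imports Defs
begin

text \<open>
  Fix a minimum cut with side \<open>S\<close>, and write \<open>c\<close> and \<open>a\<close> for the numbers of cut edges and of other
  edges at a vertex. As the cut has fewer than \<open>\<delta>\<close> edges, no side is a single vertex, so moving one
  vertex across the cut yields another cut; hence \<open>c \<le> a\<close>, and \<open>a \<ge> \<delta>/2\<close>. The cut survives if no
  star edge crosses it; given \<open>R\<close>, this has probability \<open>\<Prod> a\<^sub>R / (a\<^sub>R + c\<^sub>R)\<close>, where \<open>a\<^sub>R\<close> and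
  \<open>c\<^sub>R\<close> count the neighbors in \<open>R\<close>. By a Chernoff bound, \<open>a\<^sub>R \<ge> p\<delta>/4\<close> at all vertices except with
  tiny probability, and then the product is at least \<open>exp (- Y)\<close>, where \<open>Y\<close> is the sum of the
  \<open>4 c\<^sub>R / (p\<delta>)\<close>. Since the \<open>c\<close> add up to \<open>2\<lambda>\<close>, \<open>Y\<close> has expectation at most \<open>8\<lambda>/\<delta> \<le> 8\<close>, and
  \<open>exp (- Y) \<ge> exp (- 8) (9 - Y)\<close> turns this into a bound on the probability.

  The number of supervertices is at most \<open>|R|\<close> as soon as every vertex outside \<open>R\<close> has a neighbor in
  \<open>R\<close>, and both this and \<open>|R| \<le> 2pn\<close> fail with polynomially small probability only.
\<close>

section \<open>Simple graphs: edges, neighborhoods and crossing edges\<close>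

lemma simple_graph_edgeE:
  assumes "simple_graph V E" "e \<in> E"
  obtains u v where "e = {u, v}" "u \<noteq> v" "u \<in> V" "v \<in> V"
proof -
  have "e \<subseteq> V" "card e = 2" using assms by (auto simp: simple_graph_def)
  then show thesis using that by (auto simp: card_2_iff)
qed

lemma simple_graph_finite_edges: "simple_graph V E \<Longrightarrow> finite E"
  by (rule finite_subset[of _ "Pow V"]) (auto simp: simple_graph_def)

lemma neighbors_subset: "simple_graph V E \<Longrightarrow> neighbors E v \<subseteq> V"
  by (auto simp: simple_graph_def neighbors_def)

lemma finite_neighbors: "simple_graph V E \<Longrightarrow> finite (neighbors E v)"
  by (rule finite_subset[of _ V]) (simp_all add: neighbors_subset, simp add: simple_graph_def)

lemma card_doubleton_Int_eq_1:
  assumes "u \<noteq> v"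
  shows "card ({u, v} \<inter> S) = 1 \<longleftrightarrow> (u \<in> S) \<noteq> (v \<in> S)"
  using assms by (cases "u \<in> S"; cases "v \<in> S") auto

lemma mem_edge_cut:
  assumes "simple_graph V E" "{u, v} \<in> E"
  shows "{u, v} \<in> edge_cut E S \<longleftrightarrow> (u \<in> S) \<noteq> (v \<in> S)"
proof -
  have "u \<noteq> v" using assms by (auto simp: simple_graph_def)
  then show ?thesis using assms(2) card_doubleton_Int_eq_1[of u v S] by (simp add: edge_cut_def)
qed

section \<open>Cuts of a contracted graph\<close>

text \<open>Gives the classes in \<open>connected_comps\<close> a name, so that two supervertices
  can be compared through representatives. The relation on ordered pairs is symmetric because
  \<open>{x, y}\<close> is unordered.\<close>

definition component :: "'a set \<Rightarrow> 'a set set \<Rightarrow> 'a \<Rightarrow> 'a set" where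
  "component V F v = {u \<in> V. (v, u) \<in> {(x, y). {x, y} \<in> F}\<^sup>*}"

lemma connected_comps_eq: "connected_comps V F = component V F ` V"
  by (simp add: connected_comps_def component_def)

lemma equiv_reachable: "equiv UNIV ({(x, y). {x, y} \<in> F}\<^sup>*)"
  by (intro equivI refl_rtrancl sym_rtrancl trans_rtrancl)
    (auto simp: sym_def insert_commute)

lemma component_eq_iff:
  assumes "u \<in> V" "v \<in> V"
  shows "component V F u = component V F v \<longleftrightarrow> (u, v) \<in> {(x, y). {x, y} \<in> F}\<^sup>*"
proof
  assume "component V F u = component V F v"
  then have "v \<in> component V F u" using assms by (simp add: component_def)
  then show "(u, v) \<in> {(x, y). {x, y} \<in> F}\<^sup>*" by (simp add: component_def)
next
  assume "(u, v) \<in> {(x, y). {x, y} \<in> F}\<^sup>*"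
  from equiv_class_eq[OF equiv_reachable this] show "component V F u = component V F v"
    by (simp add: component_def set_eq_iff Image_iff)
qed

lemma component_eqI: "{u, v} \<in> F \<Longrightarrow> u \<in> V \<Longrightarrow> v \<in> V \<Longrightarrow> component V F u = component V F v"
  by (subst component_eq_iff) auto

text \<open>Supervertices are equivalence classes of reachability, so membership becomes an equation
  between classes. Disjointness of supervertices then comes for free.\<close>

lemma mem_connected_comps:
  assumes "K \<in> connected_comps V F" "v \<in> V"
  shows "v \<in> K \<longleftrightarrow> component V F v = K"
proof -
  obtain u where u: "u \<in> V" "K = component V F u" using assms(1) by (auto simp: connected_comps_eq)
  have "v \<in> K \<longleftrightarrow> (u, v) \<in> {(x, y). {x, y} \<in> F}\<^sup>*" using assms(2) by (simp add: u(2) component_def)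
  also have "\<dots> \<longleftrightarrow> component V F u = component V F v" using component_eq_iff[OF u(1) assms(2)] by simp
  finally show ?thesis using u(2) by auto
qed

lemma component_self: "v \<in> V \<Longrightarrow> v \<in> component V F v"
  by (simp add: component_def)

lemma connected_comps_subset: "K \<in> connected_comps V F \<Longrightarrow> K \<subseteq> V"
  by (auto simp: connected_comps_eq component_def)

lemma Union_connected_comps_subset:
  assumes "A \<subseteq> connected_comps V F"
  shows "\<Union>A = {v \<in> V. component V F v \<in> A}"
proof (intro equalityI subsetI)
  fix v assume "v \<in> \<Union>A"
  then obtain K where K: "K \<in> A" "v \<in> K" by blast
  then have C: "K \<in> connected_comps V F" using assms by blast
  have "v \<in> V" using K(2) connected_comps_subset[OF C] by blast
  then show "v \<in> {v \<in> V. component V F v \<in> A}"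
    using K mem_connected_comps[OF C] by simp
next
  fix v assume "v \<in> {v \<in> V. component V F v \<in> A}"
  then show "v \<in> \<Union>A" using component_self[of v V F] by (intro UnionI[of "component V F v"]) simp_all
qed

text \<open>An edge leaving \<open>\<Union>A\<close> joins exactly one supervertex in
  \<open>A\<close> to exactly one outside, so the multiplicities count it once. Cuts of the
  contracted graph are thus the cuts of \<open>G\<close> that split no supervertex.\<close>

lemma contract_cut_eq:
  assumes G: "simple_graph V E" and A: "A \<subseteq> connected_comps V F"
  shows "(\<Sum>S\<in>A. \<Sum>T\<in>mverts (contract V E F) - A. mult (contract V E F) S T)
           = card (edge_cut E (\<Union>A))"
proof -
  let ?C = "connected_comps V F"
  have finE: "finite E" by (rule simple_graph_finite_edges[OF G])
  have finC: "finite ?C" using G by (simp add: connected_comps_eq simple_graph_def)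
  then have finA: "finite A" by (rule finite_subset[OF A])
  have cut: "edge_cut E (\<Union>A) = (\<Union>(S, T) \<in> A \<times> (?C - A). edges_between E S T)"
  proof (intro equalityI subsetI)
    fix e assume e: "e \<in> edge_cut E (\<Union>A)"
    then have "e \<in> E" by (simp add: edge_cut_def)
    then obtain u v where uv: "e = {u, v}" "u \<noteq> v" "u \<in> V" "v \<in> V"
      using G simple_graph_edgeE by metis
    have *: "(u \<in> \<Union>A) \<noteq> (v \<in> \<Union>A)" using e \<open>e \<in> E\<close> mem_edge_cut[OF G] uv(1) by metis
    have gen: "\<exists>S\<in>A. \<exists>T\<in>?C - A. e \<in> edges_between E S T"
      if "e = {x, y}" "x \<in> V" "y \<in> V" "x \<in> \<Union>A" "y \<notin> \<Union>A" for x y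
    proof (intro bexI)
      show "component V F x \<in> A" "component V F y \<in> ?C - A"
        using that unfolding Union_connected_comps_subset[OF A] by (auto simp: connected_comps_eq)
      show "e \<in> edges_between E (component V F x) (component V F y)"
        unfolding edges_between_def using that \<open>e \<in> E\<close> by (auto simp: component_def)
    qed
    have "\<exists>S\<in>A. \<exists>T\<in>?C - A. e \<in> edges_between E S T"
      using * uv gen[of u v] gen[of v u] by (auto simp: insert_commute)
    then show "e \<in> (\<Union>(S, T) \<in> A \<times> (?C - A). edges_between E S T)" by blast
  next
    fix e assume "e \<in> (\<Union>(S, T) \<in> A \<times> (?C - A). edges_between E S T)"
    then obtain S T u v where ST: "S \<in> A" "T \<in> ?C" "T \<notin> A" "u \<in> S" "v \<in> T" "e = {u, v}" "{u, v} \<in> E"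
      by (auto simp: edges_between_def)
    then have V: "u \<in> V" "v \<in> V" using G by (auto simp: simple_graph_def)
    have "component V F v = T" using ST(2,5) V(2) mem_connected_comps by metis
    then have "v \<notin> \<Union>A" using ST(3) unfolding Union_connected_comps_subset[OF A] by simp
    moreover have "u \<in> \<Union>A" using ST by blast
    ultimately have "u \<in> \<Union>A" "v \<notin> \<Union>A" by simp_all
    then show "e \<in> edge_cut E (\<Union>A)" using ST mem_edge_cut[OF G] by metis
  qed
  have disj: "edges_between E S T \<inter> edges_between E S' T' = {}"
    if "S \<in> A" "T \<in> ?C - A" "S' \<in> A" "T' \<in> ?C - A" "(S, T) \<noteq> (S', T')" for S T S' T'
  proof (rule ccontr)
    assume "edges_between E S T \<inter> edges_between E S' T' \<noteq> {}"
    then obtain u v u' v' where uv: "u \<in> S" "v \<in> T" "u' \<in> S'" "v' \<in> T'" "{u, v} = {u', v'}" "{u, v} \<in> E"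
      by (auto simp: edges_between_def)
    have V: "u \<in> V" "v \<in> V" "u' \<in> V" "v' \<in> V"
      using uv G by (auto simp: simple_graph_def)
    have "S \<in> ?C" "T \<in> ?C" "S' \<in> ?C" "T' \<in> ?C" using that A by blast+
    then have eq: "S = component V F u" "T = component V F v" "S' = component V F u'" "T' = component V F v'"
      using uv(1-4) V by (simp_all add: mem_connected_comps)
    from uv(5) consider "u = u'" "v = v'" | "u = v'" by (auto simp: doubleton_eq_iff)
    then show False
    proof cases
      case 1
      then show False using that(5) eq by simp
    next
      \<comment> \<open>The same edge read in the opposite direction: its endpoint \<open>u\<close>
        would lie in \<open>S\<close>, which is in \<open>A\<close>, and in \<open>T'\<close>, which
        is not.\<close>
      case 2
      then show False using that(1,4) eq by simp
    qed
  qed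
  have "card (edge_cut E (\<Union>A)) = (\<Sum>(S, T) \<in> A \<times> (?C - A). card (edges_between E S T))"
    unfolding cut
  proof (subst card_UN_disjoint)
    show "finite (A \<times> (?C - A))" using finA finC by simp
    show "\<forall>P\<in>A \<times> (?C - A). finite (case P of (S, T) \<Rightarrow> edges_between E S T)"
      using finE by (auto simp: edges_between_def)
    show "\<forall>P\<in>A \<times> (?C - A). \<forall>Q\<in>A \<times> (?C - A). P \<noteq> Q \<longrightarrow>
        (case P of (S, T) \<Rightarrow> edges_between E S T) \<inter> (case Q of (S, T) \<Rightarrow> edges_between E S T) = {}"
      using disj by fast
  qed (simp only: split_def)
  also have "\<dots> = (\<Sum>S\<in>A. \<Sum>T\<in>?C - A. card (edges_between E S T))"
    by (simp add: sum.cartesian_product)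
  also have "\<dots> = (\<Sum>S\<in>A. \<Sum>T\<in>mverts (contract V E F) - A. mult (contract V E F) S T)"
    using A by (intro sum.cong) (auto simp: contract_def)
  finally show ?thesis by simp
qed

lemma edge_connectivity_le:
  "S \<noteq> {} \<Longrightarrow> S \<subset> V \<Longrightarrow> edge_connectivity V E \<le> card (edge_cut E S)"
  unfolding edge_connectivity_def by (intro cINF_lower) auto

text \<open>Contraction never lowers the connectivity, since every cut of the contracted graph is a
  cut of \<open>G\<close>. It does not raise it either: no contracted edge crosses \<open>S\<close>,
  so \<open>S\<close> is a union of supervertices and its cut survives.\<close>

lemma medge_connectivity_contract_eq:
  assumes G: "simple_graph V E" and S: "S \<noteq> {}" "S \<subset> V"
    and min: "card (edge_cut E S) = edge_connectivity V E"
    and F: "F \<subseteq> E" "F \<inter> edge_cut E S = {}"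
  shows "medge_connectivity (contract V E F) = edge_connectivity V E"
proof -
  let ?H = "contract V E F" and ?C = "connected_comps V F"
  let ?f = "\<lambda>A. \<Sum>S\<in>A. \<Sum>T\<in>mverts ?H - A. mult ?H S T"
  define A0 where "A0 = component V F ` S"
  have A0: "A0 \<subseteq> ?C" using S by (auto simp: A0_def connected_comps_eq)
  have closed: "u \<in> S" if "(v, u) \<in> {(x, y). {x, y} \<in> F}\<^sup>*" "v \<in> S" for u v
    using that
  proof (induction rule: rtrancl_induct)
    case (step y z)
    then show ?case using F mem_edge_cut[OF G, of y z S] by blast
  qed
  have U0: "\<Union>A0 = S"
  proof
    show "\<Union>A0 \<subseteq> S" using closed by (auto simp: A0_def component_def)
    show "S \<subseteq> \<Union>A0" using S by (auto simp: A0_def component_def)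
  qed
  have V: "\<Union>?C = V" using connected_comps_subset by (auto simp: connected_comps_eq component_def)
  have A0ne: "A0 \<noteq> {}" "A0 \<subset> ?C" using A0 U0 V S by auto
  have mv: "mverts ?H = ?C" by (simp add: contract_def)
  have "medge_connectivity ?H \<le> ?f A0"
    unfolding medge_connectivity_def using A0ne mv by (intro cINF_lower) auto
  also have "\<dots> = edge_connectivity V E" using contract_cut_eq[OF G A0] U0 min by simp
  finally have le: "medge_connectivity ?H \<le> edge_connectivity V E" .
  have "edge_connectivity V E \<le> medge_connectivity ?H"
    unfolding medge_connectivity_def
  proof (rule cINF_greatest)
    show "{A. A \<noteq> {} \<and> A \<subset> mverts ?H} \<noteq> {}" using A0ne mv by blast
    fix A assume "A \<in> {A. A \<noteq> {} \<and> A \<subset> mverts ?H}"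
    then have A: "A \<noteq> {}" "A \<subset> ?C" by (auto simp: mv)
    then have AC: "A \<subseteq> ?C" by blast
    note U = Union_connected_comps_subset[OF AC]
    obtain u where "u \<in> V" "component V F u \<in> A" using A by (auto simp: connected_comps_eq)
    moreover obtain v where "v \<in> V" "component V F v \<notin> A" using A by (auto simp: connected_comps_eq)
    ultimately have "\<Union>A \<noteq> {}" "\<Union>A \<subset> V" unfolding U by blast+
    then show "edge_connectivity V E \<le> ?f A"
      unfolding contract_cut_eq[OF G AC] by (rule edge_connectivity_le)
  qed
  with le show ?thesis by simp
qed

text \<open>Every vertex is in \<open>R\<close> or contracted into a vertex of \<open>R\<close>, so
  each supervertex is the component of some element of \<open>R\<close>.\<close>

lemma card_mverts_contract_le:
  assumes "finite R" "R \<subseteq> V" and c: "\<And>v. v \<in> V - R \<Longrightarrow> \<exists>u\<in>R. {v, u} \<in> F"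
  shows "card (mverts (contract V E F)) \<le> card R"
proof -
  have "connected_comps V F \<subseteq> component V F ` R"
  proof
    fix K assume "K \<in> connected_comps V F"
    then obtain v where v: "v \<in> V" "K = component V F v" by (auto simp: connected_comps_eq)
    show "K \<in> component V F ` R"
    proof (cases "v \<in> R")
      case False
      then obtain u where "u \<in> R" "{v, u} \<in> F" using c v by blast
      then show ?thesis using v assms(2) component_eqI[of v u F V] by auto
    qed (use v in auto)
  qed
  then show ?thesis
    using \<open>finite R\<close> by (simp add: contract_def) (meson card_image_le card_mono finite_imageI le_trans)
qed

section \<open>Degrees and minimum cuts\<close>

text \<open>Lets the cut edges be treated as a graph of their own, whose degrees count the cut edges
  at each vertex.\<close>

lemma simple_graph_edge_cut: "simple_graph V E \<Longrightarrow> simple_graph V (edge_cut E S)"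
  by (auto simp: simple_graph_def edge_cut_def)

lemma vertex_degree_eq_card_neighbors:
  assumes "simple_graph V E"
  shows "vertex_degree E v = card (neighbors E v)"
proof -
  have "bij_betw (\<lambda>u. {v, u}) (neighbors E v) {e \<in> E. v \<in> e}"
    unfolding bij_betw_def
  proof
    show "inj_on (\<lambda>u. {v, u}) (neighbors E v)"
      by (auto simp: inj_on_def doubleton_eq_iff)
    show "(\<lambda>u. {v, u}) ` neighbors E v = {e \<in> E. v \<in> e}"
    proof (intro equalityI subsetI)
      fix e assume e: "e \<in> {e \<in> E. v \<in> e}"
      then obtain a b where "e = {a, b}" using assms simple_graph_edgeE by blast
      with e show "e \<in> (\<lambda>u. {v, u}) ` neighbors E v"
        by (auto simp: insert_commute neighbors_def)
    qed (auto simp: neighbors_def)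
  qed
  then show ?thesis unfolding vertex_degree_def by (metis bij_betw_same_card)
qed

lemma min_degree_le:
  assumes "simple_graph V E" "v \<in> V"
  shows "min_degree V E \<le> vertex_degree E v"
  unfolding min_degree_def using assms(2) by (intro cINF_lower) auto

lemma sum_vertex_degree:
  assumes G: "simple_graph V E"
  shows "(\<Sum>v\<in>V. vertex_degree E v) = 2 * card E"
  unfolding vertex_degree_def
proof (rule sum_multicount)
  show "finite V" using G by (simp add: simple_graph_def)
  show "finite E" by (rule simple_graph_finite_edges[OF G])
  show "\<forall>e\<in>E. card {v \<in> V. v \<in> e} = 2"
  proof
    fix e assume "e \<in> E"
    then have "e \<subseteq> V" "card e = 2" using G by (auto simp: simple_graph_def)
    moreover from this have "{v \<in> V. v \<in> e} = e" by blast
    ultimately show "card {v \<in> V. v \<in> e} = 2" by simp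
  qed
qed

text \<open>Moving \<open>v\<close> to the other side exchanges the cut and non-cut edges at
  \<open>v\<close> and leaves all other edges alone. By minimality the cut does not shrink, so at
  most half of the edges at \<open>v\<close> cross it.\<close>

lemma min_cut_degree_le_half:
  assumes G: "simple_graph V E" and S: "S \<noteq> {}" "S \<subset> V" and v: "v \<in> V"
    and min: "card (edge_cut E S) = edge_connectivity V E"
    and lt: "edge_connectivity V E < min_degree V E"
  shows "2 * vertex_degree (edge_cut E S) v \<le> vertex_degree E v"
proof -
  define T where "T = (if v \<in> S then S - {v} else insert v S)"
  define I where "I = {e \<in> E. v \<in> e}"
  let ?C = "edge_cut E S"
  have finE: "finite E" by (rule simple_graph_finite_edges[OF G])
  have finC: "finite ?C" and finI: "finite I" using finE by (auto simp: edge_cut_def I_def)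
  have cI: "card I = vertex_degree E v" by (simp add: I_def vertex_degree_def)
  have "{e \<in> ?C. v \<in> e} = ?C \<inter> I" by (auto simp: I_def edge_cut_def)
  then have cc: "vertex_degree ?C v = card (?C \<inter> I)" by (simp add: vertex_degree_def)
  have flip: "e \<in> edge_cut E T \<longleftrightarrow> (if v \<in> e then e \<notin> ?C else e \<in> ?C)" if e: "e \<in> E" for e
  proof -
    obtain x y where xy: "e = {x, y}" "x \<noteq> y" using G e simple_graph_edgeE by metis
    then show ?thesis
      using mem_edge_cut[OF G, of x y S] mem_edge_cut[OF G, of x y T] e by (auto simp: T_def)
  qed
  have cutT: "edge_cut E T = (?C - I) \<union> (I - ?C)"
  proof (rule set_eqI)
    fix e
    have "?C \<subseteq> E" "edge_cut E T \<subseteq> E" by (auto simp: edge_cut_def)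
    then show "e \<in> edge_cut E T \<longleftrightarrow> e \<in> (?C - I) \<union> (I - ?C)"
      using flip[of e] by (cases "e \<in> E") (auto simp: I_def)
  qed
  \<comment> \<open>If moving \<open>v\<close> emptied one side, every edge at \<open>v\<close>
    would cross the old cut, which would then have at least \<delta> edges.\<close>
  have T: "T \<noteq> {} \<and> T \<subset> V"
  proof (rule ccontr)
    assume "\<not> (T \<noteq> {} \<and> T \<subset> V)"
    then have "T = {} \<or> T = V" using S v by (auto simp: T_def split: if_splits)
    then have "edge_cut E T = {}"
    proof
      assume "T = V"
      then have "card (e \<inter> T) = 2" if "e \<in> E" for e
        using G that by (auto simp: simple_graph_def Int_absorb2)
      then show ?thesis by (auto simp: edge_cut_def)
    qed (auto simp: edge_cut_def)
    then have "I \<subseteq> ?C" using cutT by blast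
    then have "card I \<le> card ?C" by (rule card_mono[OF finC])
    then show False using min lt cI min_degree_le[OF G v] by simp
  qed
  have "card ?C \<le> card (edge_cut E T)" using T min edge_connectivity_le by metis
  also have "\<dots> = card (?C - I) + card (I - ?C)"
    unfolding cutT using finC finI by (intro card_Un_disjoint) auto
  finally have "card (?C \<inter> I) \<le> card (I - ?C)"
    using finC card_Diff_subset_Int[of ?C I] card_mono[of ?C "?C \<inter> I"] finI by auto
  moreover have "card (I - ?C) = card I - card (?C \<inter> I)"
    using finC finI card_Diff_subset_Int[of I ?C] by (simp add: Int_commute)
  moreover have "card (?C \<inter> I) \<le> card I" using finI by (simp add: card_mono)
  ultimately show ?thesis using cI cc by linarith
qed

section \<open>Random vertex sets and star choices\<close>

text \<open>The law of total probability, used to condition on \<open>R\<close>.\<close>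

lemma measure_bind_pmf:
  "measure_pmf.prob (bind_pmf M f) X = measure_pmf.expectation M (\<lambda>x. measure_pmf.prob (f x) X)"
proof -
  have int: "integrable (measure_pmf M) (\<lambda>x. measure_pmf.prob (f x) X)"
    by (rule measure_pmf.integrable_const_bound[where B = 1]) auto
  have "ennreal (measure_pmf.prob (bind_pmf M f) X) = (\<integral>\<^sup>+x. ennreal (measure_pmf.prob (f x) X) \<partial>measure_pmf M)"
    by (simp flip: measure_pmf.emeasure_eq_measure)
  also have "\<dots> = ennreal (measure_pmf.expectation M (\<lambda>x. measure_pmf.prob (f x) X))"
    by (rule nn_integral_eq_integral[OF int]) simp
  finally show ?thesis
    by (simp add: integral_nonneg_AE)
qed

lemma set_random_subset: "R \<in> set_pmf (random_subset V p) \<Longrightarrow> R \<subseteq> V"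
  by (auto simp: random_subset_def)

lemma integrable_random_subset:
  fixes f :: "'a set \<Rightarrow> real"
  assumes "finite V"
  shows "integrable (measure_pmf (random_subset V p)) f"
proof (rule integrable_measure_pmf_finite)
  show "finite (set_pmf (random_subset V p))"
    by (rule finite_subset[of _ "Pow V"]) (use assms set_random_subset in auto)
qed

lemma expectation_random_subset_mono:
  fixes f g :: "'a set \<Rightarrow> real"
  assumes "finite V" "\<And>R. R \<subseteq> V \<Longrightarrow> f R \<le> g R"
  shows "measure_pmf.expectation (random_subset V p) f \<le> measure_pmf.expectation (random_subset V p) g"
  by (rule integral_mono_AE) (use assms in \<open>auto intro!: integrable_random_subset AE_pmfI dest: set_random_subset\<close>)

lemma random_subset_ge_1:
  assumes "finite V" "1 \<le> p"
  shows "random_subset V p = return_pmf V"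
proof -
  have "bernoulli_pmf p = return_pmf True"
    using assms(2) by (intro pmf_eqI) (auto simp: bernoulli_pmf.rep_eq pmf_return split: split_indicator)
  then show ?thesis using assms(1) by (simp add: random_subset_def)
qed

text \<open>The binomial generating function: each vertex of \<open>B\<close> independently
  contributes a factor \<open>x\<close> with probability \<open>p\<close> and 1 otherwise. For
  \<open>x = 0\<close>, as \<open>0 ^ 0 = 1\<close>, it gives the probability that \<open>R\<close>
  misses \<open>B\<close>.\<close>

lemma expectation_power_card_random_subset:
  fixes p x :: real
  assumes V: "finite V" "B \<subseteq> V" and p: "0 \<le> p" "p \<le> 1" and x: "0 \<le> x"
  shows "measure_pmf.expectation (random_subset V p) (\<lambda>R. x ^ card (B \<inter> R)) = (1 - p * (1 - x)) ^ card B"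
proof -
  define h where "h = (\<lambda>v b. if v \<in> B \<and> b then x else (1::real))"
  have eq: "x ^ card (B \<inter> {v \<in> V. f v}) = (\<Prod>v\<in>V. h v (f v))" for f
  proof -
    have "(\<Prod>v\<in>V. h v (f v)) = (\<Prod>v\<in>{v \<in> V. v \<in> B \<and> f v}. x)"
      unfolding h_def using V(1) by (subst prod.inter_filter) auto
    also have "{v \<in> V. v \<in> B \<and> f v} = B \<inter> {v \<in> V. f v}" by auto
    finally show ?thesis by simp
  qed
  have "measure_pmf.expectation (random_subset V p) (\<lambda>R. x ^ card (B \<inter> R))
      = measure_pmf.expectation (Pi_pmf V False (\<lambda>_. bernoulli_pmf p)) (\<lambda>f. \<Prod>v\<in>V. h v (f v))"
    by (simp add: random_subset_def eq)
  also have "\<dots> = (\<Prod>v\<in>V. measure_pmf.expectation (bernoulli_pmf p) (h v))"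
    using V(1) x by (intro expectation_prod_Pi_pmf integrable_measure_pmf_finite) (auto simp: h_def)
  also have "\<dots> = (\<Prod>v\<in>V. if v \<in> B then 1 - p * (1 - x) else 1)"
    using p by (intro prod.cong) (auto simp: h_def algebra_simps)
  also have "\<dots> = (\<Prod>v\<in>{v \<in> V. v \<in> B}. 1 - p * (1 - x))"
    using V(1) by (subst prod.inter_filter) auto
  also have "{v \<in> V. v \<in> B} = B" using V(2) by auto
  finally show ?thesis by simp
qed

lemma expectation_card_random_subset:
  assumes V: "finite V" "B \<subseteq> V" and p: "0 \<le> p" "p \<le> 1"
  shows "measure_pmf.expectation (random_subset V p) (\<lambda>R. real (card (B \<inter> R))) = p * card B"
proof -
  have finB: "finite B" using V finite_subset by auto
  \<comment> \<open>\<open>1 - 0 ^ card ({v} \<inter> R)\<close> is the indicator of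
    \<open>v \<in> R\<close>, so linearity reduces the claim to the generating function of a
    singleton at 0.\<close>
  have eq: "real (card (B \<inter> R)) = (\<Sum>v\<in>B. 1 - 0 ^ card ({v} \<inter> R))" for R
  proof -
    have "(\<Sum>v\<in>B. 1 - 0 ^ card ({v} \<inter> R)) = (\<Sum>v\<in>B. if v \<in> R then 1 else (0::real))"
      by (intro sum.cong) auto
    also have "\<dots> = (\<Sum>v\<in>{v \<in> B. v \<in> R}. 1)"
      using finB by (subst sum.inter_filter) auto
    also have "{v \<in> B. v \<in> R} = B \<inter> R" by auto
    finally show ?thesis by simp
  qed
  have "measure_pmf.expectation (random_subset V p) (\<lambda>R. 1 - 0 ^ card ({v} \<inter> R)) = p" if "v \<in> B" for v
    using expectation_power_card_random_subset[of V "{v}" p 0] that V p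
    by (subst Bochner_Integration.integral_diff) (auto intro: integrable_random_subset)
  then show ?thesis
    unfolding eq using V(1)
    by (subst Bochner_Integration.integral_sum) (auto intro!: integrable_random_subset)
qed

text \<open>Markov's inequality for \<open>k * x ^ card (B \<inter> R)\<close>, followed by
  \<open>1 - y \<le> exp (- y)\<close>. Taking \<open>x > 1\<close> bounds an upper tail,
  \<open>0 < x < 1\<close> a lower tail, and \<open>x = 0\<close> the event that \<open>R\<close>
  misses \<open>B\<close>.\<close>

lemma prob_random_subset_le:
  fixes p x k :: real
  assumes V: "finite V" "B \<subseteq> V" and p: "0 \<le> p" "p \<le> 1" and x: "0 \<le> x" and k: "0 \<le> k"
    and Q: "\<And>R. R \<subseteq> V \<Longrightarrow> Q R \<Longrightarrow> 1 \<le> k * x ^ card (B \<inter> R)"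
  shows "measure_pmf.prob (random_subset V p) {R. Q R} \<le> k * exp (- (p * (1 - x) * card B))"
proof -
  let ?M = "random_subset V p"
  have "measure_pmf.prob ?M {R. Q R} = measure_pmf.expectation ?M (\<lambda>R. indicator {R. Q R} R)"
    by simp
  also have "\<dots> \<le> measure_pmf.expectation ?M (\<lambda>R. k * x ^ card (B \<inter> R))"
    using V(1) by (rule expectation_random_subset_mono) (use Q k x in \<open>auto simp: indicator_def\<close>)
  also have "\<dots> = k * (1 - p * (1 - x)) ^ card B"
    using expectation_power_card_random_subset[OF V p x] by simp
  also have "\<dots> \<le> k * exp (- (p * (1 - x))) ^ card B"
  proof (intro mult_left_mono power_mono k)
    show "1 - p * (1 - x) \<le> exp (- (p * (1 - x)))"
      using exp_ge_add_one_self[of "- (p * (1 - x))"] by simp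
    \<comment> \<open>Monotonicity of powers needs a nonnegative base; as a convex combination of 1
      and \<open>x\<close> it is nonnegative on either side of \<open>x = 1\<close>.\<close>
    have eq: "1 - p * (1 - x) = (1 - p) + p * x" by (simp add: algebra_simps)
    show "0 \<le> 1 - p * (1 - x)" unfolding eq using p x by simp
  qed
  also have "\<dots> = k * exp (- (p * (1 - x) * card B))"
    by (simp add: exp_of_nat_mult[symmetric] mult.commute)
  finally show ?thesis .
qed

text \<open>Conditioning on \<open>R\<close> separates the two random stages: a lower bound for the
  star choices at each fixed \<open>R\<close> is averaged over \<open>R\<close>. The bound
  \<open>g\<close> may take negative values.\<close>

lemma prob_uniform_star_contraction_ge:
  assumes V: "finite V"
    and g: "\<And>R. R \<subseteq> V \<Longrightarrow> g R \<le>
      measure_pmf.prob (Pi_pmf (attached V E R) undefined (\<lambda>v. pmf_of_set (neighbors E v \<inter> R)))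
        {c. contract V E ((\<lambda>v. {v, c v}) ` attached V E R) \<in> X}"
  shows "measure_pmf.expectation (random_subset V p) g
    \<le> measure_pmf.prob (uniform_star_contraction V E p) X"
proof -
  have "measure_pmf.prob (uniform_star_contraction V E p) X
    = measure_pmf.expectation (random_subset V p) (\<lambda>R. measure_pmf.prob
        (Pi_pmf (attached V E R) undefined (\<lambda>v. pmf_of_set (neighbors E v \<inter> R)))
        {c. contract V E ((\<lambda>v. {v, c v}) ` attached V E R) \<in> X})"
    unfolding uniform_star_contraction_def measure_bind_pmf map_pmf_def[symmetric] measure_map_pmf
    by (simp add: vimage_def)
  then show ?thesis using expectation_random_subset_mono[OF V g] by simp
qed

lemma uniform_star_contraction_ge_1:
  assumes "finite V" "1 \<le> p"
  shows "uniform_star_contraction V E p = return_pmf (contract V E {})"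
proof -
  have "attached V E V = {}" by (auto simp: attached_def)
  then show ?thesis
    by (simp add: uniform_star_contraction_def random_subset_ge_1[OF assms] bind_return_pmf)
qed

lemma star_choice_mem:
  assumes G: "simple_graph V E"
    and c: "c \<in> set_pmf (Pi_pmf (attached V E R) undefined (\<lambda>v. pmf_of_set (neighbors E v \<inter> R)))"
    and v: "v \<in> attached V E R"
  shows "c v \<in> neighbors E v \<inter> R"
proof -
  have fin: "finite (attached V E R)" using G by (auto simp: simple_graph_def attached_def)
  have "neighbors E v \<inter> R \<noteq> {}" using v by (simp add: attached_def)
  then have "set_pmf (pmf_of_set (neighbors E v \<inter> R)) = neighbors E v \<inter> R"
    by (intro set_pmf_of_set) (simp_all add: finite_neighbors[OF G])
  then show ?thesis using c v by (auto simp: set_Pi_pmf[OF fin] PiE_dflt_def)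
qed

text \<open>The choices are independent and uniform on nonempty finite sets, so each attached vertex
  contributes its fraction of allowed neighbors in \<open>R\<close>.\<close>

lemma prob_star_choice_avoids:
  assumes G: "simple_graph V E"
  shows "measure_pmf.prob (Pi_pmf (attached V E R) undefined (\<lambda>v. pmf_of_set (neighbors E v \<inter> R)))
      {c. \<forall>v\<in>attached V E R. c v \<notin> C v}
    = (\<Prod>v\<in>attached V E R. card ((neighbors E v - C v) \<inter> R) / card (neighbors E v \<inter> R))"
proof -
  have fin: "finite (attached V E R)" using G by (auto simp: simple_graph_def attached_def)
  have "{c. \<forall>v\<in>attached V E R. c v \<notin> C v} = Pi (attached V E R) (\<lambda>v. - C v)" by auto
  then have "measure_pmf.prob (Pi_pmf (attached V E R) undefined (\<lambda>v. pmf_of_set (neighbors E v \<inter> R)))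
      {c. \<forall>v\<in>attached V E R. c v \<notin> C v}
    = (\<Prod>v\<in>attached V E R. measure_pmf.prob (pmf_of_set (neighbors E v \<inter> R)) (- C v))"
    by (simp only: measure_Pi_pmf_Pi[OF fin])
  also have "\<dots> = (\<Prod>v\<in>attached V E R. card ((neighbors E v - C v) \<inter> R) / card (neighbors E v \<inter> R))"
  proof (rule prod.cong[OF refl])
    fix v assume "v \<in> attached V E R"
    then have "neighbors E v \<inter> R \<noteq> {}" by (simp add: attached_def)
    moreover have "neighbors E v \<inter> R \<inter> - C v = (neighbors E v - C v) \<inter> R" by auto
    ultimately show "measure_pmf.prob (pmf_of_set (neighbors E v \<inter> R)) (- C v)
        = card ((neighbors E v - C v) \<inter> R) / card (neighbors E v \<inter> R)"
      by (simp add: measure_pmf_of_set finite_neighbors[OF G])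
  qed
  finally show ?thesis .
qed

section \<open>Numerical estimates and existence of a minimum cut\<close>

lemma exp_neg_mult_ln:
  assumes "n \<noteq> 0"
  shows "exp (- (real m * ln (real n))) = 1 / real n ^ m"
  using assms by (simp add: exp_minus exp_of_nat_mult inverse_eq_divide)

text \<open>Inverts \<open>1 + c / a \<le> 1 + c / b \<le> exp (c / b)\<close>. With
  \<open>a\<close> safe and \<open>c\<close> crossing neighbors in \<open>R\<close>, it bounds the
  chance that one vertex chooses safely.\<close>

lemma exp_neg_div_le:
  fixes a b c :: real
  assumes "0 < b" "b \<le> a" "0 \<le> c"
  shows "exp (- (c / b)) \<le> a / (a + c)"
proof -
  have "(a + c) / a = 1 + c / a" using assms by (simp add: field_simps)
  also have "\<dots> \<le> 1 + c / b" using assms by (simp add: frac_le)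
  also have "\<dots> \<le> exp (c / b)" by (rule exp_ge_add_one_self)
  finally have "exp (- (c / b)) \<le> inverse ((a + c) / a)"
    unfolding exp_minus using assms by (intro le_imp_inverse_le) auto
  then show ?thesis using assms by simp
qed

lemma card_ge_2_if_connectivity_less:
  assumes G: "simple_graph V E" and lt: "edge_connectivity V E < min_degree V E"
  shows "2 \<le> card V"
proof -
  have fin: "finite V" using G by (simp add: simple_graph_def)
  have "V \<noteq> {}" using lt by (auto simp: edge_connectivity_def min_degree_def)
  then obtain v where v: "v \<in> V" by blast
  have "0 < vertex_degree E v" using min_degree_le[OF G v] lt by simp
  then have "neighbors E v \<noteq> {}" by (auto simp: vertex_degree_eq_card_neighbors[OF G])
  then obtain u where u: "{v, u} \<in> E" by (auto simp: neighbors_def)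
  then have "{v, u} \<subseteq> V" "card {v, u} = 2" using G by (auto simp: simple_graph_def)
  then show ?thesis using card_mono[OF fin, of "{v, u}"] by simp
qed

text \<open>An infimum of naturals is attained once the family is nonempty, and with two vertices a
  singleton is a proper side.\<close>

lemma ex_min_cut:
  assumes "2 \<le> card V"
  obtains S where "S \<noteq> {}" "S \<subset> V" "card (edge_cut E S) = edge_connectivity V E"
proof -
  let ?X = "{S. S \<noteq> {} \<and> S \<subset> V}"
  have "V \<noteq> {}" using assms by auto
  then obtain v where "v \<in> V" by blast
  moreover have "{v} \<noteq> V" using assms by auto
  ultimately have "{v} \<in> ?X" by auto
  then have "(\<lambda>S. card (edge_cut E S)) ` ?X \<noteq> {}" by blast
  from Inf_nat_def1[OF this] obtain S where "S \<in> ?X" "edge_connectivity V E = card (edge_cut E S)"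
    unfolding edge_connectivity_def by (rule imageE)
  then show thesis using that[of S] by simp
qed

section \<open>The two probability bounds\<close>

lemma prob_card_mverts_ge:
  fixes p :: real
  assumes G: "simple_graph V E" and n: "n = card V" "2 \<le> n"
    and d: "0 < min_degree V E"
    and p: "p = 1200 * ln (real n) / real (min_degree V E)" "p \<le> 1"
  shows "1 - 1 / real n ^ 4 \<le> measure_pmf.prob (uniform_star_contraction V E p)
           {H. real (card (mverts H)) \<le> 2 * p * n}"
proof -
  let ?M = "random_subset V p" and ?d = "min_degree V E"
  have fin: "finite V" using G by (simp add: simple_graph_def)
  have ln: "0 < ln (real n)" using n by simp
  have p0: "0 \<le> p" using p ln by simp
  have pd: "p * ?d = 1200 * ln n" using p d by simp
  \<comment> \<open>Together with \<open>pd\<close> this yields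
    \<open>p * n \<ge> 1200 * ln n\<close>, which makes the tail of \<open>card R\<close>
    polynomially small.\<close>
  have dn: "?d \<le> n"
  proof -
    have "V \<noteq> {}" using n by auto
    then obtain v where v: "v \<in> V" by blast
    have "?d \<le> card (neighbors E v)"
      using min_degree_le[OF G v] vertex_degree_eq_card_neighbors[OF G] by metis
    also have "\<dots> \<le> n" unfolding n(1) by (rule card_mono[OF fin neighbors_subset[OF G]])
    finally show ?thesis .
  qed
  define big where "big R \<longleftrightarrow> 2 * p * n < card R" for R :: "'a set"
  define lonely where "lonely v R \<longleftrightarrow> neighbors E v \<inter> R = {}" for v and R :: "'a set"
  let ?bad = "{R. big R} \<union> (\<Union>v\<in>V. {R. lonely v R})"
  have big: "measure_pmf.prob ?M {R. big R} \<le> 1 / real n ^ 5"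
  proof -
    \<comment> \<open>Chernoff bound with \<open>x = exp 1\<close>: the exponent is
      \<open>- 2 * p * n + p * n * (exp 1 - 1)\<close>, negative because
      \<open>exp 1 < 3\<close>.\<close>
    have "measure_pmf.prob ?M {R. big R}
        \<le> exp (- (2 * p * n)) * exp (- (p * (1 - exp 1) * card V))"
    proof (rule prob_random_subset_le)
      fix R assume R: "R \<subseteq> V" "big R"
      then have "1 \<le> exp (real (card R) - 2 * p * n)" by (simp add: big_def)
      also have "\<dots> = exp (- (2 * p * n)) * exp 1 ^ card (V \<inter> R)"
        using R by (simp add: exp_of_nat_mult[symmetric] Int_absorb1 exp_diff exp_minus field_simps)
      finally show "1 \<le> exp (- (2 * p * n)) * exp 1 ^ card (V \<inter> R)" .
    qed (use fin p0 p in auto)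
    also have "\<dots> = exp (p * n * (exp 1 - 3))"
      unfolding exp_add[symmetric] n(1)[symmetric] by (simp add: algebra_simps)
    also have "\<dots> \<le> exp (- (real 5 * ln n))"
    proof -
      have "1200 * ln n \<le> p * n" unfolding pd[symmetric] using dn p0 by (intro mult_left_mono) auto
      moreover have "exp 1 - 3 \<le> - (1/10 :: real)" using e_less_272 by simp
      ultimately have "p * n * (exp 1 - 3) \<le> p * n * (- (1/10))"
        using p0 by (intro mult_left_mono) auto
      then show ?thesis using \<open>1200 * ln n \<le> p * n\<close> ln by simp
    qed
    also have "\<dots> = 1 / real n ^ 5" using n by (intro exp_neg_mult_ln) auto
    finally show ?thesis .
  qed
  have lonely: "measure_pmf.prob ?M {R. lonely v R} \<le> 1 / real n ^ 6" if v: "v \<in> V" for v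
  proof -
    \<comment> \<open>Here \<open>x = 0\<close>, for which the power is the indicator of
      \<open>R\<close> missing the neighborhood.\<close>
    have "measure_pmf.prob ?M {R. lonely v R} \<le> 1 * exp (- (p * (1 - 0) * card (neighbors E v)))"
      by (rule prob_random_subset_le) (use fin p0 p neighbors_subset[OF G] in \<open>auto simp: lonely_def\<close>)
    also have "\<dots> \<le> exp (- (real 6 * ln n))"
    proof -
      have "?d \<le> card (neighbors E v)"
        using min_degree_le[OF G v] vertex_degree_eq_card_neighbors[OF G] by metis
      then have "p * ?d \<le> p * card (neighbors E v)" using p0 by (intro mult_left_mono) auto
      then show ?thesis using pd ln by simp
    qed
    also have "\<dots> = 1 / real n ^ 6" using n by (intro exp_neg_mult_ln) auto
    finally show ?thesis .
  qed
  have "measure_pmf.prob ?M ?bad \<le> measure_pmf.prob ?M {R. big R} + (\<Sum>v\<in>V. measure_pmf.prob ?M {R. lonely v R})"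
    using fin by (intro order_trans[OF measure_Un_le] add_mono measure_UNION_le) auto
  also have "\<dots> \<le> 1 / real n ^ 5 + (\<Sum>v\<in>V. 1 / real n ^ 6)"
    by (intro add_mono big sum_mono lonely)
  \<comment> \<open>The union over \<open>n\<close> vertices costs one power of \<open>n\<close>,
    leaving \<open>2 / n ^ 5\<close>; the factor 2 is absorbed by \<open>n \<ge> 2\<close>.\<close>
  also have "\<dots> = 2 / n * (1 / real n ^ 4)"
    using n by (simp add: n(1)[symmetric] field_simps power_numeral_reduce)
  also have "\<dots> \<le> 1 * (1 / real n ^ 4)"
    using n by (intro mult_right_mono) auto
  finally have bad: "measure_pmf.prob ?M ?bad \<le> 1 / real n ^ 4" by simp
  have "1 - 1 / real n ^ 4 \<le> 1 - measure_pmf.prob ?M ?bad" using bad by simp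
  also have "\<dots> = measure_pmf.prob ?M (- ?bad)"
    using measure_pmf.prob_compl[of ?bad ?M] by (simp add: Compl_eq_Diff_UNIV)
  also have "\<dots> = measure_pmf.expectation ?M (indicator (- ?bad))" by simp
  also have "\<dots> \<le> measure_pmf.prob (uniform_star_contraction V E p)
           {H. real (card (mverts H)) \<le> 2 * p * n}"
  proof (rule prob_uniform_star_contraction_ge[OF fin])
    fix R assume R: "R \<subseteq> V"
    let ?P = "Pi_pmf (attached V E R) undefined (\<lambda>v. pmf_of_set (neighbors E v \<inter> R))"
    let ?X = "{c. contract V E ((\<lambda>v. {v, c v}) ` attached V E R) \<in> {H. real (card (mverts H)) \<le> 2 * p * n}}"
    show "indicator (- ?bad) R \<le> measure_pmf.prob ?P ?X"
    proof (cases "R \<in> ?bad")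
      case False
      \<comment> \<open>For a good \<open>R\<close> the bound holds for every possible outcome of
        the star choices, as all vertices outside \<open>R\<close> are attached.\<close>
      have "measure_pmf.prob ?P ?X = 1"
      proof (intro measure_pmf.prob_eq_1[THEN iffD2] AE_pmfI)
        fix c assume c: "c \<in> set_pmf ?P"
        have "card (mverts (contract V E ((\<lambda>v. {v, c v}) ` attached V E R))) \<le> card R"
        proof (rule card_mverts_contract_le)
          fix v assume v: "v \<in> V - R"
          then have "v \<in> attached V E R" using False by (auto simp: attached_def lonely_def)
          then show "\<exists>u\<in>R. {v, u} \<in> (\<lambda>v. {v, c v}) ` attached V E R"
            using star_choice_mem[OF G c] by blast
        qed (use R fin finite_subset in auto)
        then show "c \<in> ?X" using False by (simp add: big_def)
      qed simp
      then show ?thesis by (simp add: indicator_def)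
    qed simp
  qed
  finally show ?thesis .
qed

text \<open>Replacing the conditional survival probability by a function linear in \<open>Y\<close>
  leaves only the mean of \<open>Y\<close> and the probability of a sparse vertex to be estimated;
  the dependence between vertices does not matter.\<close>

lemma prob_medge_connectivity_ge:
  fixes p :: real
  assumes G: "simple_graph V E" and n: "n = card V" "2 \<le> n"
    and lt: "edge_connectivity V E < min_degree V E"
    and p: "p = 1200 * ln (real n) / real (min_degree V E)" "p \<le> 1"
  shows "2 / 3 ^ 13 \<le> measure_pmf.prob (uniform_star_contraction V E p)
           {H. medge_connectivity H = edge_connectivity V E}"
proof -
  let ?M = "random_subset V p" and ?d = "min_degree V E"
  have fin: "finite V" using G by (simp add: simple_graph_def)
  have ln: "0 < ln (real n)" using n by simp
  have d: "0 < ?d" using lt by simp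
  have p0: "0 < p" using p ln d by simp
  have pd: "p * ?d = 1200 * ln n" using p d by simp
  obtain S where S: "S \<noteq> {}" "S \<subset> V" and min: "card (edge_cut E S) = edge_connectivity V E"
    using ex_min_cut n by metis
  \<comment> \<open>\<open>C v\<close> collects the neighbors across the minimum cut,
    \<open>A v\<close> those on the same side as \<open>v\<close>.\<close>
  define C where "C v = neighbors (edge_cut E S) v" for v
  define A where "A v = neighbors E v - C v" for v
  have CV: "C v \<subseteq> V" and CN: "C v \<subseteq> neighbors E v" and AV: "A v \<subseteq> V" for v
    using neighbors_subset[OF G, of v] by (auto simp: C_def A_def neighbors_def edge_cut_def)
  have finC: "finite (C v)" and finA: "finite (A v)" for v
    using finite_subset[OF CV fin] finite_subset[OF AV fin] .
  have sumC: "(\<Sum>v\<in>V. card (C v)) = 2 * edge_connectivity V E"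
    using sum_vertex_degree[OF simple_graph_edge_cut[OF G, of S]] min
    by (simp add: C_def vertex_degree_eq_card_neighbors[OF simple_graph_edge_cut[OF G]])
  have cardA: "real ?d / 2 \<le> card (A v)" if v: "v \<in> V" for v
  proof -
    have "2 * card (C v) \<le> card (neighbors E v)"
      using min_cut_degree_le_half[OF G S v min lt]
      by (simp add: C_def vertex_degree_eq_card_neighbors[OF simple_graph_edge_cut[OF G]]
        vertex_degree_eq_card_neighbors[OF G])
    moreover have "card (A v) = card (neighbors E v) - card (C v)"
      unfolding A_def by (rule card_Diff_subset[OF finC CN])
    moreover have "?d \<le> card (neighbors E v)"
      using min_degree_le[OF G v] vertex_degree_eq_card_neighbors[OF G] by metis
    ultimately show ?thesis by linarith
  qed
  \<comment> \<open>Half of \<open>p * ?d / 2\<close>, the lower bound on the mean of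
    \<open>card (A v \<inter> R)\<close> given by \<open>cardA\<close>.\<close>
  define b where "b = p * ?d / 4"
  have b: "b = 300 * ln n" "0 < b" using pd ln by (simp_all add: b_def)
  define sparse where "sparse v R \<longleftrightarrow> card (A v \<inter> R) < b" for v and R :: "'a set"
  let ?bad = "\<Union>v\<in>V. {R. sparse v R}"
  have sparse: "measure_pmf.prob ?M {R. sparse v R} \<le> 1 / real n ^ 20" if v: "v \<in> V" for v
  proof -
    \<comment> \<open>Chernoff bound with \<open>x = exp (- 1)\<close>. From
      \<open>exp 1 \<ge> 5 / 2\<close> the total exponent is at most
      \<open>b - 6 / 5 * b = - 60 * ln n\<close>.\<close>
    have "measure_pmf.prob ?M {R. sparse v R} \<le> exp b * exp (- (p * (1 - exp (- 1)) * card (A v)))"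
    proof (rule prob_random_subset_le)
      fix R assume "sparse v R"
      then have "1 \<le> exp (b - real (card (A v \<inter> R)))" by (simp add: sparse_def)
      also have "\<dots> = exp b * exp (- 1) ^ card (A v \<inter> R)"
        by (simp add: exp_of_nat_mult[symmetric] exp_diff exp_minus field_simps)
      finally show "1 \<le> exp b * exp (- 1) ^ card (A v \<inter> R)" .
    qed (use fin p0 p AV in auto)
    also have "\<dots> \<le> exp (- (real 20 * ln n))"
    proof -
      have "5 / 2 \<le> exp (1 :: real)" using exp_lower_Taylor_quadratic[of 1] by simp
      then have e: "3 / 5 \<le> 1 - exp (- 1 :: real)"
        by (simp add: exp_minus field_simps)
      have "2 * b * (3 / 5) = p * (3 / 5) * (?d / 2)" by (simp add: b_def)
      also have "\<dots> \<le> p * (1 - exp (- 1)) * card (A v)"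
        using e p0 cardA[OF v] by (intro mult_mono) auto
      finally show ?thesis using b ln unfolding exp_add[symmetric] by simp
    qed
    also have "\<dots> = 1 / real n ^ 20" using n by (intro exp_neg_mult_ln) auto
    finally show ?thesis .
  qed
  have "measure_pmf.prob ?M ?bad \<le> (\<Sum>v\<in>V. measure_pmf.prob ?M {R. sparse v R})"
    using fin by (intro measure_UNION_le) auto
  also have "\<dots> \<le> (\<Sum>v\<in>V. 1 / real n ^ 20)" by (intro sum_mono sparse)
  also have "\<dots> = 1 / real n ^ 19"
    using n by (simp add: n(1)[symmetric] field_simps flip: power_Suc)
  also have "\<dots> \<le> 1 / 2 ^ 19"
    using n by (intro divide_left_mono power_mono) auto
  finally have bad: "measure_pmf.prob ?M ?bad \<le> 1 / 2 ^ 19" .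
  define Y where "Y R = (\<Sum>v\<in>V. card (C v \<inter> R) / b)" for R
  text \<open>The indicator makes \<open>g\<close> nonpositive at a bad \<open>R\<close>, because \<open>9 exp (- 8) \<le> 1\<close>.\<close>
  define g where "g R = exp (- 8) * (9 - Y R) - indicator ?bad R" for R
  have EY: "measure_pmf.expectation ?M Y \<le> 8"
  proof -
    have "measure_pmf.expectation ?M Y = (\<Sum>v\<in>V. p * card (C v) / b)"
      unfolding Y_def using expectation_card_random_subset[OF fin CV, of p] p0 p fin
      by (subst Bochner_Integration.integral_sum) (auto intro!: integrable_random_subset)
    also have "\<dots> = p / b * real (\<Sum>v\<in>V. card (C v))"
      by (simp add: sum_distrib_left)
    \<comment> \<open>The cut degrees sum to twice the cut size, and dividing by \<open>b\<close>
      contributes the factor \<open>4 / (p * ?d)\<close>.\<close>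
    also have "\<dots> = 8 * real (edge_connectivity V E) / ?d"
      using p0 d by (simp add: sumC b_def)
    also have "\<dots> \<le> 8" using lt by (simp add: divide_le_eq)
    finally show ?thesis .
  qed
  \<comment> \<open>\<open>3 ^ 8\<close> bounds \<open>exp 8\<close>, and \<open>1 / 2 ^ 19\<close>
    is the probability of a sparse vertex at \<open>n = 2\<close>, the worst case.\<close>
  have "2 / 3 ^ 13 \<le> 1 / 3 ^ 8 - (1 / 2 ^ 19 :: real)" by simp
  also have "\<dots> \<le> exp (- 8) - measure_pmf.prob ?M ?bad"
  proof (intro diff_mono bad)
    have "exp (8 :: real) = exp 1 ^ 8" by (simp flip: exp_of_nat_mult)
    also have "\<dots> \<le> 3 ^ 8" by (intro power_mono exp_le) auto
    finally show "1 / 3 ^ 8 \<le> exp (- 8 :: real)" by (simp add: exp_minus field_simps)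
  qed
  also have "\<dots> \<le> exp (- 8) * (9 - measure_pmf.expectation ?M Y) - measure_pmf.prob ?M ?bad"
    using EY by simp
  also have "\<dots> = measure_pmf.expectation ?M g"
    unfolding g_def by (simp add: integrable_random_subset[OF fin])
  also have "\<dots> \<le> measure_pmf.prob (uniform_star_contraction V E p)
           {H. medge_connectivity H = edge_connectivity V E}"
  proof (rule prob_uniform_star_contraction_ge[OF fin])
    fix R assume R: "R \<subseteq> V"
    let ?att = "attached V E R"
    let ?P = "Pi_pmf ?att undefined (\<lambda>v. pmf_of_set (neighbors E v \<inter> R))"
    let ?X = "{c. contract V E ((\<lambda>v. {v, c v}) ` ?att)
      \<in> {H. medge_connectivity H = edge_connectivity V E}}"
    have Y0: "0 \<le> Y R" using b unfolding Y_def by (intro sum_nonneg) auto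
    show "g R \<le> measure_pmf.prob ?P ?X"
    proof (cases "R \<in> ?bad")
      case True
      have "exp (- 8) * (9 - Y R) \<le> exp (- 8) * (9 :: real)" using Y0 by simp
      also have "\<dots> \<le> 1" using exp_ge_add_one_self[of 8] by (simp add: exp_minus field_simps)
      finally have "g R \<le> 0" using True by (simp add: g_def)
      then show ?thesis by (rule order_trans) simp
    next
      case False
      \<comment> \<open>The tangent to \<open>exp (- Y)\<close> at \<open>Y = 8\<close>, the bound
        on the mean, lies below the curve.\<close>
      have "g R = exp (- 8) * (1 + (8 - Y R))" using False by (simp add: g_def)
      also have "\<dots> \<le> exp (- 8) * exp (8 - Y R)"
        by (intro mult_left_mono exp_ge_add_one_self) simp
      also have "\<dots> = exp (- Y R)" by (simp flip: exp_add)
      also have "\<dots> = (\<Prod>v\<in>V. exp (- (card (C v \<inter> R) / b)))"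
        using fin by (simp add: Y_def exp_sum sum_negf[symmetric])
      \<comment> \<open>Vertices that are not attached make no choice; dropping their factors, each
        at most 1, only increases the product.\<close>
      also have "\<dots> \<le> (\<Prod>v\<in>?att. exp (- (card (C v \<inter> R) / b)))"
      proof -
        have "(\<Prod>v\<in>V. exp (- (card (C v \<inter> R) / b)))
          = (\<Prod>v\<in>V - ?att. exp (- (card (C v \<inter> R) / b))) * (\<Prod>v\<in>?att. exp (- (card (C v \<inter> R) / b)))"
          using fin by (intro prod.subset_diff) (auto simp: attached_def)
        also have "\<dots> \<le> 1 * (\<Prod>v\<in>?att. exp (- (card (C v \<inter> R) / b)))"
          using b by (intro mult_right_mono prod_le_1 prod_nonneg) auto
        finally show ?thesis by simp
      qed
      also have "\<dots> \<le> (\<Prod>v\<in>?att. card (A v \<inter> R) / card (neighbors E v \<inter> R))"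
      proof (intro prod_mono conjI)
        fix v assume "v \<in> ?att"
        then have "v \<in> V" by (simp add: attached_def)
        then have "b \<le> card (A v \<inter> R)" using False by (auto simp: sparse_def not_less)
        then have "exp (- (card (C v \<inter> R) / b)) \<le> card (A v \<inter> R) / (card (A v \<inter> R) + card (C v \<inter> R))"
          using exp_neg_div_le[of b "card (A v \<inter> R)" "card (C v \<inter> R)"] b by simp
        also have "card (A v \<inter> R) + card (C v \<inter> R) = card (neighbors E v \<inter> R)"
        proof -
          have "neighbors E v \<inter> R = (A v \<inter> R) \<union> (C v \<inter> R)" using CN by (auto simp: A_def)
          moreover have "(A v \<inter> R) \<inter> (C v \<inter> R) = {}" by (auto simp: A_def)
          ultimately show ?thesis using finA[of v] finC[of v] by (simp add: card_Un_disjoint)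
        qed
        finally show "exp (- (card (C v \<inter> R) / b)) \<le> card (A v \<inter> R) / card (neighbors E v \<inter> R)" by simp
      qed simp
      also have "\<dots> = measure_pmf.prob ?P {c. \<forall>v\<in>?att. c v \<notin> C v}"
        unfolding A_def by (rule prob_star_choice_avoids[OF G, symmetric])
      also have "\<dots> \<le> measure_pmf.prob ?P ?X"
      \<comment> \<open>The inclusion holds only on the support, where every star edge is an edge of
        \<open>G\<close>.\<close>
      proof (rule measure_pmf.finite_measure_mono_AE)
        show "AE c in ?P. c \<in> {c. \<forall>v\<in>?att. c v \<notin> C v} \<longrightarrow> c \<in> ?X"
        proof (intro AE_pmfI impI)
          fix c assume c: "c \<in> set_pmf ?P" "c \<in> {c. \<forall>v\<in>?att. c v \<notin> C v}"
          have "(\<lambda>v. {v, c v}) ` ?att \<subseteq> E"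
            using star_choice_mem[OF G c(1)] by (auto simp: neighbors_def)
          moreover have "(\<lambda>v. {v, c v}) ` ?att \<inter> edge_cut E S = {}"
            using c(2) by (auto simp: C_def neighbors_def)
          ultimately show "c \<in> ?X"
            using medge_connectivity_contract_eq[OF G S min] by simp
        qed
      qed simp
      finally show ?thesis .
    qed
  qed
  finally show ?thesis .
qed

theorem theorem2p2:
  fixes V :: "'a set" and E :: "'a set set" and n :: nat and p :: real
  assumes "simple_graph V E"
    and "n = card V"
    and "edge_connectivity V E < min_degree V E"
    and "p = 1200 * ln (real n) / real (min_degree V E)"
  shows "measure_pmf.prob (uniform_star_contraction V E p)
           {H. real (card (mverts H)) \<le> 2400 * real n * ln (real n) / real (min_degree V E)}
           \<ge> 1 - 1 / real n ^ 4
       \<and> measure_pmf.prob (uniform_star_contraction V E p)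
           {H. medge_connectivity H = edge_connectivity V E}
           \<ge> 2 / 3 ^ 13"
proof -
  have n2: "2 \<le> n" using card_ge_2_if_connectivity_less[OF assms(1,3)] assms(2) by simp
  have d: "0 < min_degree V E" using assms(3) by simp
  have eq: "2400 * real n * ln (real n) / real (min_degree V E) = 2 * p * n"
    by (simp add: assms(4))
  show ?thesis
  proof (cases "p \<le> 1")
    case True
    then show ?thesis
      unfolding eq using prob_card_mverts_ge[OF assms(1,2) n2 d assms(4)]
        prob_medge_connectivity_ge[OF assms(1,2) n2 assms(3,4)] by simp
  next
    \<comment> \<open>The parameter is truncated to 1, so \<open>R\<close> is all of
      \<open>V\<close> and nothing is contracted. The size bound then follows from
      \<open>n \<le> 2 * p * n\<close>, and every cut survives.\<close>
    case False
    have fin: "finite V" using assms(1) by (simp add: simple_graph_def)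
    have usc: "uniform_star_contraction V E p = return_pmf (contract V E {})"
      using uniform_star_contraction_ge_1[OF fin] False by simp
    have "card (mverts (contract V E {})) \<le> n"
      using card_mverts_contract_le[of V V "{}" E] fin assms(2) by simp
    moreover have "real n \<le> 2 * p * n" using False n2 by simp
    ultimately have "real (card (mverts (contract V E {}))) \<le> 2 * p * n" by linarith
    moreover obtain S where S: "S \<noteq> {}" "S \<subset> V" "card (edge_cut E S) = edge_connectivity V E"
      using ex_min_cut n2 assms(2) by metis
    then have "medge_connectivity (contract V E {}) = edge_connectivity V E"
      using medge_connectivity_contract_eq[OF assms(1) S, of "{}"] by simp
    ultimately show ?thesis unfolding eq usc by (simp add: measure_return_pmf)
  qed
qed

end
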